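(* The number of isomorphism classes of odd graphs on $n$ vertices is given by the expression \[ \frac{1}{n!} \sum_{\substack{g \in \mathrm{Sym}(n)\\ |g|\ \mathrm{even}}} 2^{c(g_E)}. \]
   Context: Here $n$ is a positive integer, $[n]=\{1,2,\ldots,n\}$, $\mathrm{Sym}(n)$ is the symmetric group on $[n]$, and $|g|$ is the order of $g \in \mathrm{Sym}(n)$. The image of $u\in[n]$ under $g$ is written $u^g$. Let $E_n=\{\{u,v\} : u,v\in[n],\ u\neq v\}$ be the set of unordered pairs of distinct elements of $[n]$. For $g\in\mathrm{Sym}(n)$, $g_E$ denotes the permutation of $E_n$ induced by $g$, i.e. $\{u,v\}\mapsto\{u^g,v^g\}$, and $c(g_E)$ denotes the number of cycles of $g_E$ on $E_n$, where fixed points count as cycles of length 1. Graphs are finite, simple and undirected. Let $X$ be a graph and assign an arbitrary orientation to its edges. An automorphism $g \in \mathrm{Aut}(X)$ (of the undirected graph $X$; it need not respect the orientation) reverses the sense of an edge $e=\{u,v\}$ if $e$ is oriented from $u$ to $v$ but the edge $e^g=\{u^g,v^g\}$ is oriented from $v^g$ to $u^g$. It is known that the parity of the number of edges whose sense is reversed by $g$ does not depend on the chosen orientation. The graph $X$ is called odd if it has an automorphism reversing the sense of an odd number of edges. For a graph with vertex set $[n]$, each edge is oriented from its lower- to its higher-numbered vertex. *)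

theory Defs
  imports
    Complex_Main
    "HOL-Algebra.Sym_Groups"
    "HOL-Algebra.Multiplicative_Group"
    "HOL-Combinatorics.Orbits"
begin

definition vertex_pairs :: "'a set \<Rightarrow> 'a set set" where
  "vertex_pairs V = {{u, v} | u v. u \<in> V \<and> v \<in> V \<and> u \<noteq> v}"

text \<open>A simple graph with vertex set \<open>V\<close> is identified with its edge set.\<close>

definition graphs_on :: "'a set \<Rightarrow> 'a set set set" where
  "graphs_on V = Pow (vertex_pairs V)"

text \<open>
  Isomorphisms between graphs on the same vertex set \<open>V\<close> are bijections \<open>V \<rightarrow> V\<close>,
  represented as permutations that are the identity outside \<open>V\<close>.
\<close>

definition graph_iso :: "'a set \<Rightarrow> 'a set set \<Rightarrow> 'a set set \<Rightarrow> ('a \<Rightarrow> 'a) \<Rightarrow> bool" where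
  "graph_iso V X Y g \<longleftrightarrow>
     g permutes V \<and> (\<forall>u\<in>V. \<forall>v\<in>V. {u, v} \<in> X \<longleftrightarrow> {g u, g v} \<in> Y)"

definition isomorphic_rel :: "'a set \<Rightarrow> ('a set set \<times> 'a set set) set" where
  "isomorphic_rel V =
     {(X, Y). X \<in> graphs_on V \<and> Y \<in> graphs_on V \<and> (\<exists>g. graph_iso V X Y g)}"

definition graph_aut :: "'a set \<Rightarrow> 'a set set \<Rightarrow> ('a \<Rightarrow> 'a) set" where
  "graph_aut V X = {g. graph_iso V X X g}"

text \<open>An orientation is given by its arcs: \<open>(u, v)\<close> means that \<open>{u, v}\<close> is oriented from \<open>u\<close> to \<open>v\<close>.\<close>

definition orientation :: "'a set set \<Rightarrow> ('a \<times> 'a) set \<Rightarrow> bool" where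
  "orientation X D \<longleftrightarrow>
     (\<forall>(u, v)\<in>D. {u, v} \<in> X) \<and>
     (\<forall>u v. {u, v} \<in> X \<longrightarrow> ((u, v) \<in> D \<longleftrightarrow> (v, u) \<notin> D))"

definition reverses_sense :: "('a \<times> 'a) set \<Rightarrow> ('a \<Rightarrow> 'a) \<Rightarrow> 'a set \<Rightarrow> bool" where
  "reverses_sense D g e \<longleftrightarrow> (\<exists>u v. e = {u, v} \<and> (u, v) \<in> D \<and> (g v, g u) \<in> D)"

definition reversed_edges ::
    "'a set set \<Rightarrow> ('a \<times> 'a) set \<Rightarrow> ('a \<Rightarrow> 'a) \<Rightarrow> 'a set set" where
  "reversed_edges X D g = {e \<in> X. reverses_sense D g e}"

definition upward_orientation :: "'a::linorder set set \<Rightarrow> ('a \<times> 'a) set" where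
  "upward_orientation X = {(u, v). {u, v} \<in> X \<and> u < v}"

text \<open>
  Oddness does not depend on the orientation used; see \<open>odd_graph_iff_any_orientation\<close> below.
\<close>

definition odd_graph :: "'a::linorder set \<Rightarrow> 'a set set \<Rightarrow> bool" where
  "odd_graph V X \<longleftrightarrow>
     (\<exists>g\<in>graph_aut V X. odd (card (reversed_edges X (upward_orientation X) g)))"

definition odd_graphs_on :: "'a::linorder set \<Rightarrow> 'a set set set" where
  "odd_graphs_on V = {X \<in> graphs_on V. odd_graph V X}"

definition edge_perm :: "'a set \<Rightarrow> ('a \<Rightarrow> 'a) \<Rightarrow> 'a set \<Rightarrow> 'a set" where
  "edge_perm V g = perm_restrict (\<lambda>e. g ` e) (vertex_pairs V)"

text \<open>The cycles of a permutation on a finite set \<open>S\<close> are its orbits; a fixed point has a singleton orbit.\<close>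

definition num_cycles :: "('a \<Rightarrow> 'a) \<Rightarrow> 'a set \<Rightarrow> nat" where
  "num_cycles f S = card {orbit f x | x. x \<in> S}"


lemma finite_vertex_pairs: "finite V \<Longrightarrow> finite (vertex_pairs V)"
  by (rule finite_subset[of _ "Pow V"]) (auto simp: vertex_pairs_def)

lemma graph_edgeE:
  assumes "X \<in> graphs_on V" "e \<in> X"
  obtains u v where "e = {u, v}" "u \<in> V" "v \<in> V" "u \<noteq> v"
  using assms unfolding graphs_on_def vertex_pairs_def by blast

lemma orientation_upward:
  assumes "X \<in> graphs_on V"
  shows "orientation X (upward_orientation X)"
  unfolding orientation_def upward_orientation_def
proof (intro conjI allI impI)
  fix u v assume "{u, v} \<in> X"
  moreover from this have "u \<noteq> v"
    using assms by (auto elim!: graph_edgeE[OF assms] simp: doubleton_eq_iff)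
  ultimately show "(u, v) \<in> {(u, v). {u, v} \<in> X \<and> u < v} \<longleftrightarrow>
      (v, u) \<notin> {(u, v). {u, v} \<in> X \<and> u < v}"
    by (auto simp: insert_commute)
qed auto

lemma graph_aut_bij_edges:
  assumes "X \<in> graphs_on V" "g \<in> graph_aut V X"
  shows "bij_betw (\<lambda>e. g ` e) X X"
proof -
  have g: "g permutes V" and iff: "\<And>u v. u \<in> V \<Longrightarrow> v \<in> V \<Longrightarrow> {u, v} \<in> X \<longleftrightarrow> {g u, g v} \<in> X"
    using assms(2) by (auto simp: graph_aut_def graph_iso_def)
  have "inj_on (\<lambda>e. g ` e) X"
    using permutes_inj[OF g] by (auto simp: inj_on_def inj_image_eq_iff)
  moreover have "g ` e \<in> X" if e: "e \<in> X" for e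
  proof -
    obtain u v where uv: "e = {u, v}" "u \<in> V" "v \<in> V"
      using graph_edgeE[OF assms(1) e] by metis
    then have "g ` e = {g u, g v}" by simp
    then show ?thesis using iff[of u v] uv e by simp
  qed
  moreover have "e \<in> (\<lambda>e. g ` e) ` X" if e: "e \<in> X" for e
  proof -
    obtain u v where uv: "e = {u, v}" "u \<in> V" "v \<in> V"
      using graph_edgeE[OF assms(1) e] by metis
    obtain u' v' where u'v': "u = g u'" "v = g v'" "u' \<in> V" "v' \<in> V"
      using permutes_image[OF g] uv(2,3) by blast
    then have "{u', v'} \<in> X" using iff e uv by simp
    then show ?thesis using uv u'v' by (intro image_eqI[of _ _ "{u', v'}"]) auto
  qed
  ultimately show ?thesis unfolding bij_betw_def by blast
qed

lemma reversed_edges_parity: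
  assumes X: "X \<in> graphs_on V" and V: "finite V" and g: "g \<in> graph_aut V X"
    and D: "orientation X D" and D': "orientation X D'"
  shows "even (card (reversed_edges X D g)) \<longleftrightarrow> even (card (reversed_edges X D' g))"
proof -
  have fin: "finite X"
    using X finite_vertex_pairs[OF V] by (auto simp: graphs_on_def intro: finite_subset)
  define S where "S = {e. \<exists>u v. e = {u, v} \<and> (u, v) \<in> D \<and> (v, u) \<in> D'}"
  let ?b = "of_bool :: bool \<Rightarrow> nat"
  let ?R = "reverses_sense D g" and ?R' = "reverses_sense D' g"
  have bij: "bij_betw (\<lambda>e. g ` e) X X" by (rule graph_aut_bij_edges[OF X g])
  have ev: "even (?b (?R e) + ?b (?R' e) + (?b (e \<in> S) + ?b (g ` e \<in> S)))" if e: "e \<in> X" for e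
  proof -
    obtain u v where uv: "e = {u, v}" "u \<in> V" "v \<in> V" "u \<noteq> v" using graph_edgeE[OF X e] .
    have ge: "{g u, g v} \<in> X"
      using bij_betwE[OF bij, rule_format, OF e] uv(1) by simp
    have r: "?R e \<longleftrightarrow> ((u, v) \<in> D \<and> (g v, g u) \<in> D) \<or> ((v, u) \<in> D \<and> (g u, g v) \<in> D)"
      and r': "?R' e \<longleftrightarrow> ((u, v) \<in> D' \<and> (g v, g u) \<in> D') \<or> ((v, u) \<in> D' \<and> (g u, g v) \<in> D')"
      unfolding reverses_sense_def uv(1) by (auto simp: doubleton_eq_iff)
    have s: "{a, b} \<in> S \<longleftrightarrow> ((a, b) \<in> D \<and> (b, a) \<in> D') \<or> ((b, a) \<in> D \<and> (a, b) \<in> D')" for a b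
      unfolding S_def by (auto simp: doubleton_eq_iff)
    have "(u, v) \<in> D \<longleftrightarrow> (v, u) \<notin> D" "(u, v) \<in> D' \<longleftrightarrow> (v, u) \<notin> D'"
      "(g u, g v) \<in> D \<longleftrightarrow> (g v, g u) \<notin> D" "(g u, g v) \<in> D' \<longleftrightarrow> (g v, g u) \<notin> D'"
      using D D' e ge uv(1) unfolding orientation_def by metis+
    moreover have "g ` e = {g u, g v}" using uv by auto
    ultimately show ?thesis
      unfolding r r' using s[of u v] s[of "g u" "g v"] uv(1) by (auto simp: of_bool_def)
  qed
  have c: "card {e \<in> X. P e} = (\<Sum>e\<in>X. ?b (P e))" for P
    using fin by (simp add: Int_def)
  have "even (\<Sum>e\<in>X. ?b (?R e) + ?b (?R' e) + (?b (e \<in> S) + ?b (g ` e \<in> S)))"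
    using ev by (rule dvd_sum)
  moreover have "(\<Sum>e\<in>X. ?b (g ` e \<in> S)) = (\<Sum>e\<in>X. ?b (e \<in> S))"
    by (rule sum.reindex_bij_betw[OF bij])
  ultimately have "even ((\<Sum>e\<in>X. ?b (?R e)) + (\<Sum>e\<in>X. ?b (?R' e)))"
    unfolding sum.distrib by (metis dvd_add_left_iff even_add)
  then show ?thesis unfolding reversed_edges_def c by simp
qed

lemma odd_graph_iff_any_orientation:
  assumes "X \<in> graphs_on V" "finite V" "orientation X D"
  shows "odd_graph V X \<longleftrightarrow> (\<exists>g\<in>graph_aut V X. odd (card (reversed_edges X D g)))"
  unfolding odd_graph_def
  using reversed_edges_parity[OF assms(1,2) _ orientation_upward[OF assms(1)] assms(3)] by blast

end

theory Submission
  imports Defs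
begin

text \<open>
  For an automorphism \<open>g\<close> of \<open>X\<close> let \<open>\<sigma>\<^sub>X(g) = \<plusminus>1\<close> be the parity of the number of edges reversed
  by \<open>g\<close>. Since \<open>\<sigma>\<^sub>X\<close> is a homomorphism on \<open>Aut(X)\<close>, the sum of \<open>1 - \<sigma>\<^sub>X(g)\<close> over \<open>Aut(X)\<close> is
  \<open>|Aut(X)|\<close> if \<open>X\<close> is odd and \<open>0\<close> otherwise, so by orbit counting \<open>n!\<close> times the number of odd
  classes is the sum of \<open>1 - \<sigma>\<^sub>X(g)\<close> over all pairs with \<open>g \<in> Aut(X)\<close>. Exchange the sums.
  If \<open>|g|\<close> is odd, then \<open>\<sigma>\<^sub>X(g) = 1\<close>. If \<open>|g|\<close> is even, then \<open>h = g\<^bsup>|g|/2\<^esup>\<close> swaps some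
  \<open>u \<noteq> v\<close>, and the \<open>g\<close>-orbit \<open>O\<close> of \<open>{u,v}\<close> has sign \<open>-1\<close>; taking the symmetric difference with
  \<open>O\<close> is then a sign-reversing involution on the graphs fixed by \<open>g\<close>, so that the values
  \<open>\<sigma>\<^sub>X(g)\<close> cancel and the contribution of \<open>g\<close> is the number \<open>2\<^bsup>c(g\<^sub>E)\<^esup>\<close> of these graphs.
\<close>

section \<open>Sets invariant under a permutation\<close>

text \<open>\<open>orbit f x\<close> starts at \<open>f x\<close>. The hypothesis that
  \<open>x\<close> recurs supplies a preimage of \<open>f x\<close> inside the orbit.\<close>

lemma image_orbit:
  assumes "x \<in> orbit f x"
  shows "f ` orbit f x = orbit f x"
proof
  show "f ` orbit f x \<subseteq> orbit f x" by (auto intro: orbit.step)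
  show "orbit f x \<subseteq> f ` orbit f x"
  proof
    fix y assume "y \<in> orbit f x"
    then show "y \<in> f ` orbit f x" by cases (use assms in auto)
  qed
qed

lemma orbits_disjoint:
  assumes f: "f permutes S" and S: "finite S" and z: "z \<in> orbit f x" "z \<in> orbit f y"
  shows "orbit f x = orbit f y"
proof -
  have "orbit f w = orbit f z" if "z \<in> orbit f w" for w
  proof -
    have "permutation f" using f S by (auto simp: permutation_permutes)
    then have "w \<in> orbit f w" by (rule permutation_self_in_orbit)
    then show ?thesis using that by (meson orbit_swap orbit_trans subsetI subset_antisym)
  qed
  then show ?thesis using z by metis
qed

text \<open>An invariant set is the union of the orbits it contains, and any set of orbits can be
  chosen freely because distinct orbits are disjoint.\<close>

lemma card_invariant_subsets:
  assumes f: "f permutes S" and S: "finite S"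
  shows "card {X. X \<subseteq> S \<and> f ` X = X} = 2 ^ num_cycles f S"
proof -
  define Q where "Q = {orbit f x | x. x \<in> S}"
  have fQ: "finite Q" unfolding Q_def using S by (simp add: setcompr_eq_image)
  have perm: "permutation f" using f S by (auto simp: permutation_permutes)
  have self: "x \<in> orbit f x" for x by (rule permutation_self_in_orbit[OF perm])
  have oS: "orbit f x \<subseteq> S" if "x \<in> S" for x using permutes_orbit_subset[OF f that] .
  have inv_orbit: "f ` orbit f x = orbit f x" for x using image_orbit[OF self] .
  have inv_sub: "orbit f x \<subseteq> X" if "f ` X = X" "x \<in> X" for X x
  proof
    fix y assume "y \<in> orbit f x"
    then show "y \<in> X" by induction (use that in auto)
  qed
  \<comment> \<open>By disjointness, an orbit inside a union of orbits is one of those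
    united.\<close>
  have recover: "{c \<in> Q. c \<subseteq> \<Union>P} = P" if "P \<subseteq> Q" for P
  proof (intro equalityI subsetI)
    fix c assume "c \<in> {c \<in> Q. c \<subseteq> \<Union>P}"
    then obtain x d where x: "c = orbit f x" "d \<in> P" "x \<in> d" unfolding Q_def using self by blast
    then obtain y where "d = orbit f y" using \<open>P \<subseteq> Q\<close> unfolding Q_def by blast
    then have "c = d" using x orbits_disjoint[OF f S _ self, of x y] by auto
    then show "c \<in> P" using x by simp
  qed (use that in auto)
  have "bij_betw Union (Pow Q) {X. X \<subseteq> S \<and> f ` X = X}"
  proof (rule bij_betw_byWitness[where f' = "\<lambda>X. {c \<in> Q. c \<subseteq> X}"])
    show "\<forall>P\<in>Pow Q. {c \<in> Q. c \<subseteq> \<Union>P} = P" using recover by blast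
    show "\<forall>X\<in>{X. X \<subseteq> S \<and> f ` X = X}. \<Union>{c \<in> Q. c \<subseteq> X} = X"
      unfolding Q_def using self inv_sub by blast
    show "Union ` Pow Q \<subseteq> {X. X \<subseteq> S \<and> f ` X = X}"
    proof clarify
      fix P assume "P \<subseteq> Q"
      then have "\<forall>c\<in>P. c \<subseteq> S \<and> f ` c = c" unfolding Q_def using oS inv_orbit by blast
      then show "\<Union>P \<subseteq> S \<and> f ` \<Union>P = \<Union>P" by (simp add: image_Union Union_least)
    qed
  qed auto
  then have "card {X. X \<subseteq> S \<and> f ` X = X} = card (Pow Q)"
    by (rule bij_betw_same_card[symmetric])
  also have "\<dots> = 2 ^ num_cycles f S" using card_Pow[OF fQ] by (simp add: num_cycles_def Q_def)
  finally show ?thesis .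
qed

section \<open>The action on graphs\<close>

lemma image_vertex_pairs:
  assumes "g permutes V"
  shows "image g ` vertex_pairs V = vertex_pairs V"
proof -
  have sub: "image h ` vertex_pairs V \<subseteq> vertex_pairs V" if "h permutes V" for h
    using permutes_in_image[OF that] permutes_inj[OF that]
    unfolding vertex_pairs_def inj_def by fastforce
  have "e \<in> image g ` vertex_pairs V" if "e \<in> vertex_pairs V" for e
  proof (rule image_eqI)
    show "e = g ` (inv' g ` e)" using permutes_surj[OF assms] by (simp add: image_f_inv_f)
    show "inv' g ` e \<in> vertex_pairs V" using sub[OF permutes_inv[OF assms]] that by blast
  qed
  then show ?thesis using sub[OF assms] by blast
qed

lemma image_graphs_on:
  "g permutes V \<Longrightarrow> X \<in> graphs_on V \<Longrightarrow> image g ` X \<in> graphs_on V"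
  using image_vertex_pairs[of g V] unfolding graphs_on_def by blast

text \<open>Turns isomorphism into the action of permutations on edge sets. Injectivity of
  \<open>g\<close> transfers membership from \<open>X\<close> to its image, and surjectivity on
  \<open>V\<close> lets the quantifiers range over all pairs.\<close>

lemma graph_iso_iff_image:
  assumes X: "X \<in> graphs_on V" and Y: "Y \<in> graphs_on V"
  shows "graph_iso V X Y g \<longleftrightarrow> g permutes V \<and> image g ` X = Y"
proof (cases "g permutes V")
  case g: True
  have "inj g" using permutes_inj[OF g] .
  then have mem: "{u, v} \<in> X \<longleftrightarrow> {g u, g v} \<in> image g ` X" for u v
    using inj_image_mem_iff[of "image g" "{u, v}" X] by (simp add: inj_image_eq_iff inj_def)
  have "(\<forall>u\<in>V. \<forall>v\<in>V. {u, v} \<in> X \<longleftrightarrow> {g u, g v} \<in> Y) \<longleftrightarrow>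
      (\<forall>u\<in>V. \<forall>v\<in>V. {g u, g v} \<in> image g ` X \<longleftrightarrow> {g u, g v} \<in> Y)"
    using mem by simp
  also have "\<dots> \<longleftrightarrow> (\<forall>u\<in>g ` V. \<forall>v\<in>g ` V. {u, v} \<in> image g ` X \<longleftrightarrow> {u, v} \<in> Y)" by blast
  also have "\<dots> \<longleftrightarrow> (\<forall>u\<in>V. \<forall>v\<in>V. {u, v} \<in> image g ` X \<longleftrightarrow> {u, v} \<in> Y)"
    by (simp only: permutes_image[OF g])
  also have "\<dots> \<longleftrightarrow> image g ` X = Y"
    (is "?L \<longleftrightarrow> ?R")
  proof
    assume ?L
    have agree: "e \<in> image g ` X \<longleftrightarrow> e \<in> Y" if "e \<in> vertex_pairs V" for e
    proof -
      obtain u v where "e = {u, v}" "u \<in> V" "v \<in> V" using \<open>e \<in> vertex_pairs V\<close>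
        unfolding vertex_pairs_def by blast
      then show ?thesis using \<open>?L\<close> by metis
    qed
    have sub: "image g ` X \<subseteq> vertex_pairs V" "Y \<subseteq> vertex_pairs V"
      using Y image_graphs_on[OF g X] unfolding graphs_on_def by (simp_all only: Pow_iff)
    show ?R
    proof (rule Set.set_eqI)
      fix e show "e \<in> image g ` X \<longleftrightarrow> e \<in> Y"
        by (metis agree sub subsetD)
    qed
  qed simp
  finally show ?thesis using g by (simp add: graph_iso_def)
qed (simp add: graph_iso_def)

lemma graph_aut_eq:
  "X \<in> graphs_on V \<Longrightarrow> graph_aut V X = {g. g permutes V \<and> image g ` X = X}"
  by (auto simp: graph_aut_def graph_iso_iff_image)

lemma isomorphic_rel_iff:
  "(X, Y) \<in> isomorphic_rel V \<longleftrightarrow> X \<in> graphs_on V \<and> (\<exists>g. g permutes V \<and> image g ` X = Y)"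
  unfolding isomorphic_rel_def mem_Collect_eq split
  by (metis graph_iso_iff_image image_graphs_on)

lemma image_comp_graph: "image (g \<circ> h) ` X = image g ` (image h ` X)"
  by (simp add: image_comp comp_def)

lemma image_inv_graph:
  assumes "g permutes V"
  shows "image (inv' g) ` (image g ` X) = X"
  using permutes_inv_o(2)[OF assms] by (simp flip: image_comp_graph)

lemma equiv_isomorphic_rel: "equiv (graphs_on V) (isomorphic_rel V)"
proof (rule equivI)
  show "isomorphic_rel V \<subseteq> graphs_on V \<times> graphs_on V" by (auto simp: isomorphic_rel_def)
  show "refl_on (graphs_on V) (isomorphic_rel V)"
    by (auto simp: refl_on_def isomorphic_rel_iff intro!: exI[of _ id] permutes_id)
  show "sym (isomorphic_rel V)"
  proof (rule symI)
    fix X Y assume "(X, Y) \<in> isomorphic_rel V"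
    then obtain g where "X \<in> graphs_on V" "g permutes V" "image g ` X = Y"
      unfolding isomorphic_rel_iff by blast
    then show "(Y, X) \<in> isomorphic_rel V"
      unfolding isomorphic_rel_iff using permutes_inv image_graphs_on image_inv_graph by metis
  qed
  show "trans (isomorphic_rel V)"
  proof (rule transI)
    fix X Y Z assume "(X, Y) \<in> isomorphic_rel V" "(Y, Z) \<in> isomorphic_rel V"
    then obtain g h where "X \<in> graphs_on V" "g permutes V" "image g ` X = Y"
      "h permutes V" "image h ` Y = Z"
      unfolding isomorphic_rel_iff by blast
    then show "(X, Z) \<in> isomorphic_rel V"
      unfolding isomorphic_rel_iff using permutes_compose image_comp_graph by metis
  qed
qed

section \<open>Orbit counting for isomorphism classes\<close>

lemma finite_graphs_on: "finite V \<Longrightarrow> finite (graphs_on V)"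
  by (simp add: graphs_on_def finite_vertex_pairs)

text \<open>The isomorphisms from \<open>X\<close> to \<open>Y\<close> form a coset of the automorphism group of \<open>Y\<close>.\<close>

lemma sum_card_graph_aut_class:
  assumes V: "finite V" and X: "X \<in> graphs_on V"
  shows "(\<Sum>Y\<in>isomorphic_rel V `` {X}. card (graph_aut V Y)) = fact (card V)"
proof -
  let ?I = "\<lambda>Y. {g. g permutes V \<and> image g ` X = Y}"
  have fp: "finite {g. g permutes V}" using finite_permutations[OF V] .
  have cls: "isomorphic_rel V `` {X} = (\<lambda>g. image g ` X) ` {g. g permutes V}"
    using X by (auto simp: isomorphic_rel_iff)
  have eq: "card (graph_aut V Y) = card (?I Y)" if Y_cls: "Y \<in> isomorphic_rel V `` {X}" for Y
  proof -
    obtain h where h: "h permutes V" "image h ` X = Y" using Y_cls unfolding cls by blast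
    have Y: "Y \<in> graphs_on V" using image_graphs_on[OF h(1) X] h(2) by simp
    have "bij_betw (\<lambda>a. a \<circ> h) (graph_aut V Y) (?I Y)"
      unfolding graph_aut_eq[OF Y]
    proof (rule bij_betw_byWitness[where f' = "\<lambda>g. g \<circ> inv' h"])
      show "(\<lambda>a. a \<circ> h) ` {g. g permutes V \<and> image g ` Y = Y} \<subseteq> ?I Y"
        by (rule image_subsetI) (simp only: mem_Collect_eq image_comp_graph permutes_compose h simp_thms)
      have ih: "image (inv' h) ` Y = X" using image_inv_graph[OF h(1)] h(2) by blast
      show "(\<lambda>g. g \<circ> inv' h) ` ?I Y \<subseteq> {g. g permutes V \<and> image g ` Y = Y}"
        by (rule image_subsetI)
          (simp only: mem_Collect_eq image_comp_graph permutes_compose permutes_inv h ih simp_thms)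
    qed (simp_all add: comp_assoc permutes_inv_o[OF h(1)])
    then show ?thesis by (rule bij_betw_same_card)
  qed
  have "(\<Sum>Y\<in>isomorphic_rel V `` {X}. card (graph_aut V Y)) =
      (\<Sum>Y\<in>(\<lambda>g. image g ` X) ` {g. g permutes V}. card (?I Y))"
    using eq unfolding cls by (intro sum.cong) auto
  \<comment> \<open>Each permutation is counted once, under the graph to which it sends
    \<open>X\<close>.\<close>
  also have "\<dots> = card {g. g permutes V}"
    using sum.image_gen[OF fp, of "\<lambda>_. 1::nat" "\<lambda>g. image g ` X"] by simp
  finally show ?thesis using card_permutations[OF refl V] by simp
qed

text \<open>Closure under relabelling makes \<open>W\<close> a disjoint union of full isomorphism
  classes, and each class contributes \<open>fact (card V)\<close>.\<close>

lemma sum_card_graph_aut: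
  assumes V: "finite V" and W: "W \<subseteq> graphs_on V"
    and closed: "\<And>X g. X \<in> W \<Longrightarrow> g permutes V \<Longrightarrow> image g ` X \<in> W"
  shows "(\<Sum>X\<in>W. card (graph_aut V X)) = card (W // isomorphic_rel V) * fact (card V)"
proof -
  let ?Q = "W // isomorphic_rel V"
  have clsW: "isomorphic_rel V `` {X} \<subseteq> W" if "X \<in> W" for X
    using closed that by (auto simp: isomorphic_rel_iff)
  have un: "\<Union>?Q = W"
  proof (intro equalityI subsetI)
    fix X assume "X \<in> \<Union>?Q"
    then show "X \<in> W" using clsW by (auto elim!: quotientE)
  next
    fix X assume "X \<in> W"
    then show "X \<in> \<Union>?Q"
      using W equiv_class_self[OF equiv_isomorphic_rel, of X V] by (auto intro: quotientI)
  qed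
  have sub: "?Q \<subseteq> graphs_on V // isomorphic_rel V" using W unfolding quotient_def by blast
  have "(\<Sum>X\<in>\<Union>?Q. card (graph_aut V X)) = (\<Sum>C\<in>?Q. \<Sum>X\<in>C. card (graph_aut V X))"
  proof (rule sum.Union_disjoint[unfolded comp_def])
    show "\<forall>C\<in>?Q. finite C"
      using un finite_subset[OF W finite_graphs_on[OF V]] by (metis Union_upper finite_subset)
    show "\<forall>C\<in>?Q. \<forall>D\<in>?Q. C \<noteq> D \<longrightarrow> C \<inter> D = {}"
      using quotient_disj[OF equiv_isomorphic_rel] sub by blast
  qed
  also have "\<dots> = (\<Sum>C\<in>?Q. fact (card V))"
    using sum_card_graph_aut_class[OF V] W by (intro sum.cong) (auto elim!: quotientE)
  finally show ?thesis by (simp add: un)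
qed

section \<open>The sign of a permutation on a graph\<close>

text \<open>Depends on the vertex order alone and on no graph, so it also makes sense for
  permutations that are not automorphisms.\<close>

definition edge_sign :: "('a::linorder \<Rightarrow> 'a) \<Rightarrow> 'a set \<Rightarrow> int" where
  "edge_sign g e = (if \<exists>u v. e = {u, v} \<and> u < v \<and> g v < g u then -1 else 1)"

definition graph_sign :: "('a::linorder \<Rightarrow> 'a) \<Rightarrow> 'a set set \<Rightarrow> int" where
  "graph_sign g X = (\<Prod>e\<in>X. edge_sign g e)"

lemma edge_sign_doubleton:
  assumes "inj g" "u \<noteq> v"
  shows "edge_sign g {u, v} = (if u < v \<longleftrightarrow> g u < g v then 1 else -1)"
proof -
  have "g u \<noteq> g v" using assms by (simp add: inj_eq)
  moreover have "(\<exists>x y. {u, v} = {x, y} \<and> x < y \<and> g y < g x) \<longleftrightarrow>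
      u < v \<and> g v < g u \<or> v < u \<and> g u < g v"
    by (auto simp: doubleton_eq_iff)
  ultimately show ?thesis using assms(2) unfolding edge_sign_def by auto
qed

lemma edge_sign_square: "edge_sign g e * edge_sign g e = 1"
  by (simp add: edge_sign_def)

text \<open>Cocycle rule: a composite inverts the order of the two ends iff exactly one of its two
  stages does.\<close>

lemma edge_sign_comp:
  assumes "inj g" "inj h" "u \<noteq> v"
  shows "edge_sign (g \<circ> h) {u, v} = edge_sign h {u, v} * edge_sign g (h ` {u, v})"
  using assms edge_sign_doubleton[of "g \<circ> h" u v] edge_sign_doubleton[of h u v]
    edge_sign_doubleton[of g "h u" "h v"]
  by (auto simp: inj_compose inj_eq)

text \<open>Iterates the cocycle rule. Read from right to left, it evaluates the sign of an orbit
  through one power of \<open>g\<close>.\<close>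

lemma edge_sign_funpow:
  assumes "inj g" "u \<noteq> v"
  shows "edge_sign (g ^^ k) {u, v} = (\<Prod>i<k. edge_sign g ((g ^^ i) ` {u, v}))"
proof (induction k)
  case (Suc k)
  show ?case
    by (simp only: funpow.simps edge_sign_comp[OF assms(1) inj_fn[OF assms(1)] assms(2)]
        prod.lessThan_Suc Suc.IH)
qed (auto simp: edge_sign_def)

lemma graph_sign_square: "graph_sign g X * graph_sign g X = 1"
  by (simp add: graph_sign_def edge_sign_square flip: prod.distrib)

lemma graph_sign_values: "graph_sign g X = 1 \<or> graph_sign g X = -1"
  using graph_sign_square[of g X] by (simp add: square_eq_1_iff)

lemma graph_sign_id: "graph_sign id X = 1"
  unfolding graph_sign_def edge_sign_def by (rule prod.neutral) auto

text \<open>The cocycle rule multiplied over all edges. When \<open>h\<close> fixes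
  \<open>X\<close>, it says that the sign is multiplicative, hence a homomorphism on the
  automorphism group.\<close>

lemma graph_sign_comp:
  assumes X: "X \<in> graphs_on V" and g: "g permutes V" and h: "h permutes V"
  shows "graph_sign (g \<circ> h) X = graph_sign h X * graph_sign g (image h ` X)"
proof -
  have inj: "inj g" "inj h" using g h by (simp_all add: permutes_inj)
  have "edge_sign (g \<circ> h) e = edge_sign h e * edge_sign g (h ` e)" if "e \<in> X" for e
    using graph_edgeE[OF X that] edge_sign_comp[OF inj] by metis
  moreover have "inj_on (image h) X" using inj(2) by (simp add: inj_on_def inj_image_eq_iff)
  ultimately show ?thesis
    unfolding graph_sign_def by (simp add: prod.distrib prod.reindex)
qed

lemma graph_sign_funpow:
  assumes X: "X \<in> graphs_on V" and g: "g permutes V" and inv: "image g ` X = X"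
  shows "graph_sign (g ^^ k) X = graph_sign g X ^ k"
proof (induction k)
  case (Suc k)
  show ?case
    by (simp only: funpow_Suc_right graph_sign_comp[OF X permutes_funpow[OF g] g] inv Suc.IH power_Suc)
qed (simp add: graph_sign_id[unfolded id_def])

text \<open>Edges common to \<open>X\<close> and \<open>Y\<close> enter the right-hand side twice,
  and the square of a sign is 1.\<close>

lemma graph_sign_sym_diff:
  assumes "finite X" "finite Y"
  shows "graph_sign g (sym_diff X Y) = graph_sign g X * graph_sign g Y"
proof -
  have X: "graph_sign g X = graph_sign g (X - Y) * graph_sign g (X \<inter> Y)"
    and Y: "graph_sign g Y = graph_sign g (Y - X) * graph_sign g (X \<inter> Y)"
    unfolding graph_sign_def using assms
    by (metis Int_commute mult.commute prod.Int_Diff)+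
  have "graph_sign g (sym_diff X Y) = graph_sign g (X - Y) * graph_sign g (Y - X)"
    unfolding graph_sign_def using assms by (intro prod.union_disjoint) auto
  then show ?thesis unfolding X Y using graph_sign_square[of g "X \<inter> Y"] by (simp add: algebra_simps)
qed

section \<open>Oddness in terms of the sign\<close>

lemma graph_sign_eq_reversed_edges:
  assumes V: "finite V" and X: "X \<in> graphs_on V" and g: "g \<in> graph_aut V X"
  shows "graph_sign g X = (-1) ^ card (reversed_edges X (upward_orientation X) g)"
proof -
  let ?R = "reversed_edges X (upward_orientation X) g"
  have fin: "finite X"
    using X finite_vertex_pairs[OF V] by (auto simp: graphs_on_def intro: finite_subset)
  have "edge_sign g e = (if e \<in> ?R then -1 else 1)" if e: "e \<in> X" for e
  proof -
    have "g ` e \<in> X" using bij_betwE[OF graph_aut_bij_edges[OF X g]] e by blast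
    \<comment> \<open>Arcs of \<open>upward_orientation X\<close> must lie over edges of
      \<open>X\<close>; with this membership only the comparison of \<open>g v\<close> and
      \<open>g u\<close> remains.\<close>
    then have "{g v, g u} \<in> X" if "e = {u, v}" for u v using that by (simp add: insert_commute)
    then show ?thesis
      using e unfolding edge_sign_def reversed_edges_def reverses_sense_def upward_orientation_def
      by auto
  qed
  then have "graph_sign g X = (\<Prod>e\<in>X. if e \<in> ?R then -1 else 1)"
    unfolding graph_sign_def by (intro prod.cong) auto
  also have "\<dots> = (\<Prod>e\<in>{e\<in>X. e \<in> ?R}. -1)" using fin by (rule prod.inter_filter[symmetric])
  also have "{e\<in>X. e \<in> ?R} = ?R" by (auto simp: reversed_edges_def)
  finally show ?thesis by simp
qed

lemma odd_graph_iff_graph_sign: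
  assumes "finite V" "X \<in> graphs_on V"
  shows "odd_graph V X \<longleftrightarrow> (\<exists>g. g permutes V \<and> image g ` X = X \<and> graph_sign g X = -1)"
proof -
  have "odd (card (reversed_edges X (upward_orientation X) g)) \<longleftrightarrow> graph_sign g X = -1"
    if "g \<in> graph_aut V X" for g
    using graph_sign_eq_reversed_edges[OF assms that]
    by (cases "even (card (reversed_edges X (upward_orientation X) g))") auto
  then show ?thesis unfolding odd_graph_def using graph_aut_eq[OF assms(2)] by auto
qed

text \<open>Conjugating an odd automorphism by \<open>g\<close> gives one of the image graph, since
  the signs of \<open>g\<close> and its inverse cancel.\<close>

lemma odd_graph_image:
  assumes V: "finite V" and X: "X \<in> graphs_on V" and odd: "odd_graph V X" and g: "g permutes V"
  shows "odd_graph V (image g ` X)"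
proof -
  obtain a where a: "a permutes V" "image a ` X = X" "graph_sign a X = -1"
    using odd odd_graph_iff_graph_sign[OF V X] by blast
  let ?Y = "image g ` X"
  have Y: "?Y \<in> graphs_on V" using image_graphs_on[OF g X] .
  have ig: "inv' g permutes V" using permutes_inv[OF g] .
  have ga: "g \<circ> a permutes V" using permutes_compose[OF a(1) g] .
  have "graph_sign g X * graph_sign (inv' g) ?Y = 1"
    using graph_sign_comp[OF X ig g] by (simp add: permutes_inv_o[OF g] graph_sign_id)
  moreover have "graph_sign (g \<circ> a \<circ> inv' g) ?Y = graph_sign (inv' g) ?Y * graph_sign (g \<circ> a) X"
    using graph_sign_comp[OF Y ga ig] image_inv_graph[OF g] by metis
  moreover have "graph_sign (g \<circ> a) X = graph_sign a X * graph_sign g X"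
    using graph_sign_comp[OF X g a(1)] a(2) by simp
  ultimately have "graph_sign (g \<circ> a \<circ> inv' g) ?Y = -1" using a(3) by (simp add: algebra_simps)
  moreover have "g \<circ> a \<circ> inv' g permutes V" using permutes_compose[OF ig ga] .
  moreover have "image (g \<circ> a \<circ> inv' g) ` ?Y = ?Y"
    unfolding image_comp_graph image_inv_graph[OF g] a(2) ..
  ultimately show ?thesis using odd_graph_iff_graph_sign[OF V Y] by blast
qed

lemma sum_one_minus_graph_sign:
  assumes V: "finite V" and X: "X \<in> graphs_on V"
  shows "(\<Sum>g\<in>graph_aut V X. 1 - graph_sign g X) =
    (if odd_graph V X then int (card (graph_aut V X)) else 0)"
proof (cases "odd_graph V X")
  case True
  then obtain a where a: "a permutes V" "image a ` X = X" "graph_sign a X = -1"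
    using odd_graph_iff_graph_sign[OF V X] by blast
  have ia: "image (inv' a) ` X = X" using image_inv_graph[OF a(1), of X] a(2) by simp
  have "bij_betw (\<lambda>g. g \<circ> a) (graph_aut V X) (graph_aut V X)"
    unfolding graph_aut_eq[OF X]
  proof (rule bij_betw_byWitness[where f' = "\<lambda>g. g \<circ> inv' a"])
    show "(\<lambda>g. g \<circ> a) ` {g. g permutes V \<and> image g ` X = X} \<subseteq> {g. g permutes V \<and> image g ` X = X}"
      by (rule image_subsetI) (simp only: mem_Collect_eq image_comp_graph permutes_compose a simp_thms)
    show "(\<lambda>g. g \<circ> inv' a) ` {g. g permutes V \<and> image g ` X = X}
        \<subseteq> {g. g permutes V \<and> image g ` X = X}"
      by (rule image_subsetI)
        (simp only: mem_Collect_eq image_comp_graph permutes_compose permutes_inv a ia simp_thms)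
  qed (simp_all add: comp_assoc permutes_inv_o[OF a(1)])
  \<comment> \<open>Composition with the odd automorphism \<open>a\<close> permutes the group and
    negates every sign, so the sum of signs equals its own negative.\<close>
  then have "(\<Sum>g\<in>graph_aut V X. graph_sign g X) = (\<Sum>g\<in>graph_aut V X. graph_sign (g \<circ> a) X)"
    by (rule sum.reindex_bij_betw[symmetric])
  also have "\<dots> = (\<Sum>g\<in>graph_aut V X. - graph_sign g X)"
    using graph_sign_comp[OF X _ a(1)] a(2,3) graph_aut_eq[OF X] by (intro sum.cong) auto
  finally show ?thesis using True by (simp add: sum_negf sum_subtractf)
next
  case False
  then have "graph_sign g X = 1" if "g \<in> graph_aut V X" for g
    using that odd_graph_iff_graph_sign[OF V X] graph_sign_values unfolding graph_aut_eq[OF X] by blast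
  then show ?thesis using False by simp
qed

section \<open>Permutations of odd and even order\<close>

lemma sym_group_nat_pow: "g [^]\<^bsub>sym_group n\<^esub> (k::nat) = g ^^ k"
proof (induction k)
  case (Suc k)
  then show ?case by (simp add: sym_group_def funpow_Suc_right del: funpow.simps)
qed (simp add: sym_group_def)

lemma sym_group_funpow_eq_id:
  assumes "g permutes {1..n}"
  shows "g ^^ k = id \<longleftrightarrow> group.ord (sym_group n) g dvd k"
  using group.pow_eq_id[OF sym_group_is_group, of g n k] assms
  by (simp add: sym_group_carrier sym_group_nat_pow sym_group_one)

text \<open>The sign is 1 or -1, and its odd power \<open>N\<close> is the sign of the
  identity.\<close>

lemma graph_sign_odd_order:
  assumes "X \<in> graphs_on V" "g permutes V" "image g ` X = X" and N: "g ^^ N = id" "odd N"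
  shows "graph_sign g X = 1"
  using graph_sign_funpow[OF assms(1-3), of N] N graph_sign_values[of g X]
  by (auto simp: graph_sign_id)

text \<open>The graph is the orbit of a pair swapped by the involution \<open>g ^^ k\<close>. The
  signs along the orbit multiply to the sign of the first power of \<open>g\<close> returning the
  pair, and that power swaps its ends.\<close>

lemma invariant_graph_of_negative_sign:
  assumes g: "g permutes V" and k: "g ^^ k \<noteq> id" "g ^^ (2 * k) = id"
  shows "\<exists>Y. Y \<in> graphs_on V \<and> image g ` Y = Y \<and> graph_sign g Y = -1"
proof -
  obtain u where u: "(g ^^ k) u \<noteq> u" using k(1) by (auto simp: fun_eq_iff)
  define v where "v = (g ^^ k) u"
  have vu: "(g ^^ k) v = u" using fun_cong[OF k(2), of u] by (simp add: v_def mult_2 funpow_add)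
  have inj: "inj g" using permutes_inj[OF g] .
  have uV: "u \<in> V" using u permutes_not_in[OF permutes_funpow[OF g]] by metis
  have vV: "v \<in> V" unfolding v_def using uV permutes_in_image[OF permutes_funpow[OF g]] by metis
  have neq: "u \<noteq> v" using u by (simp add: v_def)
  \<comment> \<open>Orbits consist of positive iterates, so the return of the pair after
    \<open>k\<close> steps must be a positive one.\<close>
  have pos: "0 < k" using k(1) by (cases k) (auto simp: id_def)
  let ?e = "{u, v}" and ?f = "image g"
  have pow: "?f ^^ i = image (g ^^ i)" for i
    by (induction i) (auto simp: fun_eq_iff image_comp)
  have fke: "(?f ^^ k) ?e = ?e" unfolding pow using vu by (auto simp flip: v_def)
  have self: "?e \<in> orbit ?f ?e"
    unfolding orbit_altdef mem_Collect_eq using fke pos by metis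
  \<comment> \<open>The first positive return time of the pair, hence the length of its
    orbit.\<close>
  define m where "m = funpow_dist1 ?f ?e ?e"
  define C where "C = orbit ?f ?e"
  have fme: "(?f ^^ m) ?e = ?e" unfolding m_def using funpow_dist1_prop[OF self] .
  have mdvd: "m dvd k"
  proof -
    have "(?f ^^ (k mod m)) ?e = ?e" using funpow_mod_eq[OF fme] fke by metis
    moreover have "k mod m < m" by (simp add: m_def)
    ultimately have "k mod m = 0" using funpow_dist1_least[of "k mod m" ?f ?e ?e] m_def by auto
    then show ?thesis by auto
  qed
  \<comment> \<open>If \<open>g ^^ m\<close> fixed \<open>u\<close>, so would \<open>g ^^ k\<close>,
    because \<open>m\<close> divides \<open>k\<close>. Thus \<open>g ^^ m\<close> preserves the pair
    only by swapping it.\<close>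
  have "(g ^^ m) u \<noteq> u"
  proof
    assume fix_u: "(g ^^ m) u = u"
    have "(g ^^ k) u = (g ^^ (k mod m)) u" using funpow_mod_eq[OF fix_u] by metis
    then show False using u mdvd by simp
  qed
  moreover have "{(g ^^ m) u, (g ^^ m) v} = {u, v}" using fme unfolding pow by simp
  ultimately have swap: "(g ^^ m) u = v" "(g ^^ m) v = u" by (auto simp: doubleton_eq_iff)
  have C_eq: "C = (\<lambda>i. (?f ^^ i) ?e) ` {0..<m}"
    unfolding C_def m_def using orbit_conv_funpow_dist1[OF self] .
  have "graph_sign g C = (\<Prod>i<m. edge_sign g ((g ^^ i) ` ?e))"
    unfolding graph_sign_def C_eq lessThan_atLeast0
    using prod.reindex[OF inj_on_funpow_dist1[OF self, folded m_def]] by (simp only: pow o_def)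
  also have "\<dots> = edge_sign (g ^^ m) ?e" using edge_sign_funpow[OF inj neq] by simp
  also have "\<dots> = -1"
    unfolding edge_sign_doubleton[OF inj_fn[OF inj] neq] swap using neq by auto
  finally have "graph_sign g C = -1" .
  moreover have "?f ` C = C" unfolding C_def using image_orbit[OF self] .
  moreover have "?e \<in> vertex_pairs V" using uV vV neq unfolding vertex_pairs_def by blast
  then have "C \<in> graphs_on V"
  proof -
    have "e \<in> vertex_pairs V" if "e \<in> orbit ?f ?e" for e
      using that \<open>?e \<in> vertex_pairs V\<close> image_vertex_pairs[OF g] by induction blast+
    then show ?thesis unfolding graphs_on_def C_def by blast
  qed
  ultimately show ?thesis by blast
qed

lemma sum_graph_sign_even_order:
  assumes V: "finite V" and g: "g permutes V" and k: "g ^^ k \<noteq> id" "g ^^ (2 * k) = id"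
  shows "(\<Sum>X | X \<in> graphs_on V \<and> image g ` X = X. graph_sign g X) = 0"
proof -
  let ?F = "{X. X \<in> graphs_on V \<and> image g ` X = X}"
  obtain Y where Y: "Y \<in> graphs_on V" "image g ` Y = Y" "graph_sign g Y = -1"
    using invariant_graph_of_negative_sign[OF g k] by blast
  have fin: "finite X" if "X \<in> graphs_on V" for X
    using that finite_vertex_pairs[OF V] by (auto simp: graphs_on_def intro: finite_subset)
  \<comment> \<open>Injectivity makes the image commute with set difference, so the symmetric
    difference of invariant graphs is invariant.\<close>
  have "inj (image g)" using permutes_inj[OF g] by (simp add: inj_def inj_image_eq_iff)
  then have closed: "sym_diff X Y \<in> ?F" if "X \<in> ?F" for X
    using that Y by (auto simp: graphs_on_def image_Un image_set_diff)
  have "bij_betw (\<lambda>X. sym_diff X Y) ?F ?F"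
    by (rule bij_betw_byWitness[where f' = "\<lambda>X. sym_diff X Y"]) (use closed in auto)
  then have "(\<Sum>X\<in>?F. graph_sign g X) = (\<Sum>X\<in>?F. graph_sign g (sym_diff X Y))"
    by (rule sum.reindex_bij_betw[symmetric])
  also have "\<dots> = (\<Sum>X\<in>?F. - graph_sign g X)"
    using graph_sign_sym_diff[OF fin fin[OF Y(1)]] Y(3) by (intro sum.cong) auto
  finally show ?thesis by (simp add: sum_negf)
qed

section \<open>Fixed graphs and the exchange of sums\<close>

text \<open>The map \<open>image g\<close> may also move sets that are not vertex pairs. Its
  restriction \<open>edge_perm V g\<close> permutes the pairs and acts alike on graphs, so the count
  of invariant subsets applies.\<close>

lemma card_invariant_graphs:
  assumes V: "finite V" and g: "g permutes V"
  shows "card {X. X \<in> graphs_on V \<and> image g ` X = X} = 2 ^ num_cycles (edge_perm V g) (vertex_pairs V)"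
proof -
  let ?E = "vertex_pairs V"
  have inj: "inj_on (edge_perm V g) ?E"
    using permutes_inj[OF g]
    by (auto simp: inj_on_def edge_perm_def perm_restrict_simps inj_image_eq_iff)
  have im: "edge_perm V g ` X = image g ` X" if "X \<subseteq> ?E" for X
    using that by (intro image_cong) (auto simp: edge_perm_def perm_restrict_simps)
  have "edge_perm V g permutes ?E"
    using inj im[OF order_refl] image_vertex_pairs[OF g]
    by (intro bij_imp_permutes) (simp_all add: bij_betw_def edge_perm_def perm_restrict_simps)
  moreover have "X \<in> graphs_on V \<and> image g ` X = X \<longleftrightarrow> X \<subseteq> ?E \<and> edge_perm V g ` X = X" for X
    by (cases "X \<subseteq> ?E") (simp_all only: im graphs_on_def Pow_iff simp_thms)
  ultimately show ?thesis by (simp only: card_invariant_subsets finite_vertex_pairs[OF V])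
qed

lemma sum_one_minus_graph_sign_invariant:
  assumes g: "g permutes {1..n}"
  shows "(\<Sum>X | X \<in> graphs_on {1..n} \<and> image g ` X = X. 1 - graph_sign g X) =
    (if even (group.ord (sym_group n) g)
     then 2 ^ num_cycles (edge_perm {1..n} g) (vertex_pairs {1..n}) else 0)"
proof (cases "even (group.ord (sym_group n) g)")
  case True
  then obtain k where k: "group.ord (sym_group n) g = 2 * k" by blast
  \<comment> \<open>Order 0 would mean infinite order and is even. Finiteness excludes it, so
    \<open>k\<close> is positive and \<open>2 * k\<close> cannot divide \<open>k\<close>.\<close>
  have "finite (carrier (sym_group n))" by (simp add: sym_group_def finite_permutations)
  then have "group.ord (sym_group n) g \<ge> 1"
    using group.ord_ge_1[OF sym_group_is_group] g by (simp add: sym_group_carrier)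
  then have "\<not> 2 * k dvd k" using k by (auto dest: dvd_imp_le)
  then have "g ^^ k \<noteq> id" "g ^^ (2 * k) = id" using sym_group_funpow_eq_id[OF g] k by simp_all
  then show ?thesis
    using True sum_graph_sign_even_order[OF _ g] card_invariant_graphs[OF _ g]
    by (simp add: sum_subtractf)
next
  case False
  have "g ^^ group.ord (sym_group n) g = id" using sym_group_funpow_eq_id[OF g] by simp
  then show ?thesis using False graph_sign_odd_order[OF _ g] by (auto intro!: sum.neutral)
qed

theorem theorem4p4:
  fixes n :: nat
  assumes "n \<ge> 1"
  shows "real (card (odd_graphs_on {1..n} // isomorphic_rel {1..n})) =
    1 / fact n *
      (\<Sum>g | g \<in> carrier (sym_group n) \<and> even (group.ord (sym_group n) g).
         2 ^ num_cycles (edge_perm {1..n} g) (vertex_pairs {1..n}))"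
proof -
  let ?V = "{1..n}"
  let ?W = "odd_graphs_on ?V" and ?G = "graphs_on ?V" and ?S = "{g. g permutes ?V}"
  let ?c = "\<lambda>g. num_cycles (edge_perm ?V g) (vertex_pairs ?V)"
  have fG: "finite ?G" by (simp add: finite_graphs_on)
  have fS: "finite ?S" by (simp add: finite_permutations)
  have "(\<Sum>X\<in>?W. card (graph_aut ?V X)) = card (?W // isomorphic_rel ?V) * fact (card ?V)"
    by (rule sum_card_graph_aut) (auto simp: odd_graphs_on_def odd_graph_image image_graphs_on)
  \<comment> \<open>The count moves to \<open>int\<close> because signs can be negative.\<close>
  then have "int (card (?W // isomorphic_rel ?V) * fact n) = (\<Sum>X\<in>?W. int (card (graph_aut ?V X)))"
    by (simp flip: of_nat_sum)
  also have "\<dots> = (\<Sum>X\<in>?G. if odd_graph ?V X then int (card (graph_aut ?V X)) else 0)"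
    unfolding odd_graphs_on_def using fG by (rule sum.inter_filter)
  \<comment> \<open>The sum of \<open>1 - graph_sign g X\<close> detects oddness, so the sum runs
    over all pairs of a graph and an automorphism and can be exchanged.\<close>
  also have "\<dots> = (\<Sum>X\<in>?G. \<Sum>g | g \<in> ?S \<and> image g ` X = X. 1 - graph_sign g X)"
    by (rule sum.cong) (simp_all add: sum_one_minus_graph_sign flip: graph_aut_eq)
  also have "\<dots> = (\<Sum>g\<in>?S. \<Sum>X | X \<in> ?G \<and> image g ` X = X. 1 - graph_sign g X)"
    using fG fS by (rule sum.swap_restrict)
  also have "\<dots> = (\<Sum>g\<in>?S. if even (group.ord (sym_group n) g) then 2 ^ ?c g else 0)"
    by (intro sum.cong refl) (simp only: mem_Collect_eq sum_one_minus_graph_sign_invariant)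
  also have "\<dots> = (\<Sum>g | g \<in> ?S \<and> even (group.ord (sym_group n) g). 2 ^ ?c g)"
    using fS by (rule sum.inter_filter[symmetric])
  also have "\<dots> = (\<Sum>g | g \<in> carrier (sym_group n) \<and> even (group.ord (sym_group n) g). 2 ^ ?c g)"
    by (simp add: sym_group_carrier)
  finally have "real_of_int (int (card (?W // isomorphic_rel ?V) * fact n)) =
      real_of_int (\<Sum>g | g \<in> carrier (sym_group n) \<and> even (group.ord (sym_group n) g). 2 ^ ?c g)"
    by simp
  then show ?thesis by (simp add: field_simps)
qed

end
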